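(* Let $\mathcal{A}$ be a finite alphabet and let $X\subseteq\mathcal{A}^{\mathbb{N}}$ be a general set (not necessarily closed). (1) If $X$ is weakly shift-stable, then all decimations $\psi_{j,n}(X)$ for $j\ge0$, $n\ge1$ are weakly shift-stable. (2) If $X_0,X_1,\dots,X_{n-1}\subseteq\mathcal{A}^{\mathbb{N}}$ are weakly shift-stable, then their $n$-fold interleaving $Y:=(\circledast_n)_{i=0}^{n-1}X_i$ is also weakly shift-stable. (3) If $X$ is weakly shift-stable, then its $n$-fold interleaving closure $X^{[n]}$ is weakly shift-stable for each $n\ge1$.
   Context: $\mathbb{N}=\{0,1,2,\dots\}$. The shift $S:\mathcal{A}^{\mathbb{N}}\to\mathcal{A}^{\mathbb{N}}$ is $S(a_0a_1a_2\cdots)=a_1a_2a_3\cdots$. A set $X\subseteq\mathcal{A}^{\mathbb{N}}$ is weakly shift-stable if there are integers $k>j\ge0$ such that $S^kX\subseteq S^jX$. For $\mathbf{x}=a_0a_1a_2\cdots$, $i\ge0$, $n\ge1$, the decimation is $\psi_{i,n}(\mathbf{x})=a_ia_{i+n}a_{i+2n}\cdots$, and $\psi_{i,n}(X)=\{\psi_{i,n}(\mathbf{x}):\mathbf{x}\in X\}$. The $n$-fold interleaving of sequences $\mathbf{x}_i=a_{i,0}a_{i,1}\cdots$ ($0\le i\le n-1$) is $b_0b_1b_2\cdots$ with $b_{i+jn}=a_{i,j}$ ($0\le i\le n-1$, $j\ge0$); the $n$-fold interleaving $(\circledast_n)_{i=0}^{n-1}X_i$ of sets is the set of all $n$-fold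 interleavings of $(\mathbf{x}_0,\dots,\mathbf{x}_{n-1})$ with $\mathbf{x}_i\in X_i$. The $n$-fold interleaving closure of $X$ is $X^{[n]}=(\circledast_n)_{i=0}^{n-1}\psi_{i,n}(X)$. *)

theory Defs
  imports "HOL-Library.FuncSet"
begin

definition shift :: "(nat \<Rightarrow> 'a) \<Rightarrow> (nat \<Rightarrow> 'a)" where
  "shift x = (\<lambda>m. x (Suc m))"

definition weakly_shift_stable :: "(nat \<Rightarrow> 'a) set \<Rightarrow> bool" where
  "weakly_shift_stable X \<longleftrightarrow>
     (\<exists>j k. j < k \<and> (shift ^^ k) ` X \<subseteq> (shift ^^ j) ` X)"

definition decimation :: "nat \<Rightarrow> nat \<Rightarrow> (nat \<Rightarrow> 'a) \<Rightarrow> (nat \<Rightarrow> 'a)" where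
  "decimation i n x = (\<lambda>m. x (i + m * n))"

text \<open>The interleaving of a family of sets only depends on the members with index below \<open>n\<close>.
  It is meaningful for \<open>n \<ge> 1\<close>, where the equations determine \<open>b\<close> uniquely from
  the \<open>x i\<close>.\<close>

definition interleaving :: "nat \<Rightarrow> (nat \<Rightarrow> (nat \<Rightarrow> 'a) set) \<Rightarrow> (nat \<Rightarrow> 'a) set" where
  "interleaving n X =
     {b. \<exists>x. (\<forall>i<n. x i \<in> X i) \<and> (\<forall>i<n. \<forall>j. b (i + j * n) = x i j)}"

definition interleaving_closure :: "nat \<Rightarrow> (nat \<Rightarrow> 'a) set \<Rightarrow> (nat \<Rightarrow> 'a) set" where
  "interleaving_closure n X = interleaving n (\<lambda>i. decimation i n ` X)"

end

theory Submission
  imports Defs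
begin

text \<open>The inclusion of \<open>S^k X\<close> in \<open>S^j X\<close> says that \<open>d = k - j > 0\<close> is a shift period of \<open>X\<close>
  from \<open>j\<close> on; then so is every multiple of \<open>d\<close> from every later index on. Hence the starting
  index and the period may be multiplied by \<open>n\<close>, which handles decimations, and finitely many sets
  have a common starting index and a common period, which handles interleavings.\<close>

text \<open>Indexing by \<open>m \<ge> j\<close> instead of writing both sides at
  \<open>m + j\<close> makes raising \<open>j\<close> a plain weakening and lets periods be chained
  without reindexing.\<close>

definition shift_period :: "nat \<Rightarrow> nat \<Rightarrow> (nat \<Rightarrow> 'a) set \<Rightarrow> bool" where
  "shift_period j d X \<longleftrightarrow> (\<forall>x\<in>X. \<exists>y\<in>X. \<forall>m\<ge>j. x (m + d) = y m)"

lemma shift_funpow: "(shift ^^ k) x m = x (m + k)"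
  by (induction k arbitrary: m) (simp_all add: shift_def)

lemma shift_image_subset_iff:
  "(shift ^^ (j + d)) ` X \<subseteq> (shift ^^ j) ` X \<longleftrightarrow> shift_period j d X"
proof -
  have "(shift ^^ (j + d)) x = (shift ^^ j) y \<longleftrightarrow> (\<forall>m\<ge>j. x (m + d) = y m)"
    for x y :: "nat \<Rightarrow> 'a"
  proof
    assume "(shift ^^ (j + d)) x = (shift ^^ j) y"
    \<comment> \<open>Both sequences are evaluated at \<open>m - j\<close>; the truncated
      subtraction cancels below, where \<open>m \<ge> j\<close>.\<close>
    then have "x (m - j + (j + d)) = y (m - j + j)" for m
      by (metis shift_funpow)
    then show "\<forall>m\<ge>j. x (m + d) = y m"
      by (metis add.assoc le_add_diff_inverse2)
  qed (simp add: fun_eq_iff shift_funpow flip: add.assoc)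
  then show ?thesis
    by (auto simp: shift_period_def image_subset_iff image_iff)
qed

lemma weakly_shift_stable_iff:
  "weakly_shift_stable X \<longleftrightarrow> (\<exists>j d. d > 0 \<and> shift_period j d X)"
proof
  assume "weakly_shift_stable X"
  then obtain j k where "j < k" "(shift ^^ k) ` X \<subseteq> (shift ^^ j) ` X"
    unfolding weakly_shift_stable_def by blast
  then have "k - j > 0" "shift_period j (k - j) X"
    by (simp_all flip: shift_image_subset_iff)
  then show "\<exists>j d. d > 0 \<and> shift_period j d X" by blast
next
  assume "\<exists>j d. d > 0 \<and> shift_period j d X"
  then obtain j d where "d > 0" "(shift ^^ (j + d)) ` X \<subseteq> (shift ^^ j) ` X"
    unfolding shift_image_subset_iff by blast
  then show "weakly_shift_stable X"
    unfolding weakly_shift_stable_def by (intro exI[of _ j] exI[of _ "j + d"]) simp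
qed

lemma shift_period_mono: "shift_period j d X \<Longrightarrow> j \<le> j' \<Longrightarrow> shift_period j' d X"
  unfolding shift_period_def by (meson order_trans)

text \<open>Periods are chained, each step replacing the current element by another one of
  \<open>X\<close>. The start \<open>j\<close> does not grow, since adding a multiple of
  \<open>d\<close> keeps an index beyond \<open>j\<close>.\<close>

lemma shift_period_mult:
  assumes "shift_period j d X"
  shows "shift_period j (t * d) X"
proof (induction t)
  case 0
  show ?case by (auto simp: shift_period_def)
next
  case (Suc t)
  show ?case unfolding shift_period_def
  proof
    fix x assume "x \<in> X"
    then obtain y where y: "y \<in> X" "\<forall>m\<ge>j. x (m + d) = y m"
      using assms unfolding shift_period_def by blast
    then obtain z where z: "z \<in> X" "\<forall>m\<ge>j. y (m + t * d) = z m"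
      using Suc unfolding shift_period_def by blast
    have "x (m + Suc t * d) = z m" if "m \<ge> j" for m
    proof -
      have "x (m + Suc t * d) = x ((m + t * d) + d)" by (simp add: ac_simps)
      also have "\<dots> = y (m + t * d)" using y(2) that by (meson le_add1 order_trans)
      finally show ?thesis using z(2) that by simp
    qed
    with z(1) show "\<exists>y\<in>X. \<forall>m\<ge>j. x (m + Suc t * d) = y m" by blast
  qed
qed

text \<open>Advancing a decimation by \<open>d\<close> advances the original sequence by
  \<open>d * n\<close>. The same \<open>j\<close> serves as start because
  \<open>i + m * n \<ge> m\<close>.\<close>

lemma shift_period_decimation:
  assumes "shift_period j (d * n) X" and "n \<ge> 1"
  shows "shift_period j d (decimation i n ` X)"
  unfolding shift_period_def
proof
  fix u assume "u \<in> decimation i n ` X"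
  then obtain x where x: "x \<in> X" "u = decimation i n x" by blast
  then obtain y where y: "y \<in> X" "\<forall>m\<ge>j. x (m + d * n) = y m"
    using assms(1) unfolding shift_period_def by blast
  have "u (m + d) = decimation i n y m" if "m \<ge> j" for m
  proof -
    have "j \<le> m * 1" using that by simp
    also have "\<dots> \<le> m * n" using assms(2) by (intro mult_le_mono) auto
    finally have "j \<le> i + m * n" by simp
    with y(2) show ?thesis by (simp add: x(2) decimation_def add_mult_distrib flip: add.assoc)
  qed
  with y(1) show "\<exists>v\<in>decimation i n ` X. \<forall>m\<ge>j. u (m + d) = v m" by blast
qed

lemma weakly_shift_stable_decimation:
  assumes "weakly_shift_stable X" and "n \<ge> 1"
  shows "weakly_shift_stable (decimation i n ` X)"
proof -
  obtain j d where "d > 0" "shift_period j d X"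
    using assms(1) unfolding weakly_shift_stable_iff by blast
  then have "shift_period j d (decimation i n ` X)"
    using assms(2) by (metis mult.commute shift_period_decimation shift_period_mult)
  with \<open>d > 0\<close> show ?thesis unfolding weakly_shift_stable_iff by blast
qed

text \<open>The maximum of the starts and the product of the periods work for both the old sets and
  the new one.\<close>

lemma common_shift_period:
  assumes "finite I" and "\<forall>i\<in>I. weakly_shift_stable (X i)"
  shows "\<exists>j d. d > 0 \<and> (\<forall>i\<in>I. shift_period j d (X i))"
  using assms
proof (induction I rule: finite_induct)
  case empty
  show ?case by auto
next
  case (insert a I)
  then obtain j d where jd: "d > 0" "\<forall>i\<in>I. shift_period j d (X i)" by blast
  obtain j' d' where jd': "d' > 0" "shift_period j' d' (X a)"
    using insert.prems unfolding weakly_shift_stable_iff by blast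
  have "shift_period (max j j') (d' * d) (X i)" if "i \<in> insert a I" for i
  proof (cases "i = a")
    case True
    then show ?thesis
      using jd'(2) by (metis max.cobounded2 mult.commute shift_period_mono shift_period_mult)
  next
    case False
    then show ?thesis
      using jd(2) that by (metis insertE max.cobounded1 shift_period_mono shift_period_mult)
  qed
  then show ?case using jd(1) jd'(1) by (metis mult_pos_pos)
qed

text \<open>The family witnessing membership is forced to consist of the decimations of
  \<open>b\<close>, so membership splits into independent conditions on the residue classes modulo
  \<open>n\<close>.\<close>

lemma mem_interleaving_iff:
  assumes "n \<ge> 1"
  shows "b \<in> interleaving n X \<longleftrightarrow> (\<forall>i<n. decimation i n b \<in> X i)"
proof
  assume "b \<in> interleaving n X"
  then obtain x where "\<forall>i<n. x i \<in> X i" "\<forall>i<n. decimation i n b = x i"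
    unfolding interleaving_def decimation_def by fastforce
  then show "\<forall>i<n. decimation i n b \<in> X i" by simp
next
  assume "\<forall>i<n. decimation i n b \<in> X i"
  then show "b \<in> interleaving n X"
    unfolding interleaving_def
    by (intro CollectI exI[of _ "\<lambda>i. decimation i n b"]) (simp add: decimation_def)
qed

text \<open>A shift by \<open>d * n\<close> preserves residues modulo \<open>n\<close>, so it acts
  on every component as a shift by the same \<open>d\<close>; this is why a common period is
  required.\<close>

lemma shift_period_interleaving:
  assumes "n \<ge> 1" and "\<forall>i<n. shift_period j d (X i)"
  shows "shift_period (j * n) (d * n) (interleaving n X)"
  unfolding shift_period_def
proof
  fix b assume "b \<in> interleaving n X"
  then have "\<forall>i<n. \<exists>y\<in>X i. \<forall>m\<ge>j. decimation i n b (m + d) = y m"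
    using assms by (simp add: mem_interleaving_iff shift_period_def)
  then obtain y where y: "\<And>i. i < n \<Longrightarrow> y i \<in> X i"
    "\<And>i m. i < n \<Longrightarrow> m \<ge> j \<Longrightarrow> decimation i n b (m + d) = y i m"
    by metis
  \<comment> \<open>The components \<open>y i\<close> are chosen separately and then interleaved:
    position \<open>m\<close> is entry \<open>m div n\<close> of component
    \<open>m mod n\<close>.\<close>
  define c where "c = (\<lambda>m. y (m mod n) (m div n))"
  have "decimation i n c = y i" if "i < n" for i
    using that by (simp add: decimation_def c_def)
  then have "c \<in> interleaving n X"
    using assms(1) y(1) by (simp add: mem_interleaving_iff)
  moreover have "b (m + d * n) = c m" if "m \<ge> j * n" for m
  proof -
    \<comment> \<open>The start \<open>j * n\<close> is what brings every component index
      \<open>m div n\<close> up to \<open>j\<close>.\<close>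
    have "m div n \<ge> j"
      using that assms(1) by (simp add: less_eq_div_iff_mult_less_eq)
    moreover have "m mod n < n" using assms(1) by simp
    ultimately have "decimation (m mod n) n b (m div n + d) = c m"
      using y(2) by (simp add: c_def)
    then show ?thesis by (simp add: decimation_def add_mult_distrib flip: add.assoc)
  qed
  ultimately show "\<exists>c\<in>interleaving n X. \<forall>m\<ge>j * n. b (m + d * n) = c m" by blast
qed

lemma weakly_shift_stable_interleaving:
  assumes "n \<ge> 1" and "\<forall>i<n. weakly_shift_stable (X i)"
  shows "weakly_shift_stable (interleaving n X)"
proof -
  obtain j d where "d > 0" "\<forall>i<n. shift_period j d (X i)"
    using common_shift_period[of "{..<n}" X] assms(2) by auto
  then have "shift_period (j * n) (d * n) (interleaving n X)" "d * n > 0"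
    using assms(1) by (simp_all add: shift_period_interleaving)
  then show ?thesis
    unfolding weakly_shift_stable_iff by blast
qed

theorem theorem2p15:
  fixes A :: "'a set" and X :: "(nat \<Rightarrow> 'a) set"
  assumes "finite A" and "X \<subseteq> UNIV \<rightarrow> A"
  shows "(weakly_shift_stable X \<longrightarrow>
            (\<forall>j n. n \<ge> 1 \<longrightarrow> weakly_shift_stable (decimation j n ` X))) \<and>
         (\<forall>n (Xs :: nat \<Rightarrow> (nat \<Rightarrow> 'a) set).
            n \<ge> 1 \<longrightarrow> (\<forall>i<n. Xs i \<subseteq> UNIV \<rightarrow> A) \<longrightarrow> (\<forall>i<n. weakly_shift_stable (Xs i)) \<longrightarrow>
            weakly_shift_stable (interleaving n Xs)) \<and>
         (weakly_shift_stable X \<longrightarrow>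
            (\<forall>n. n \<ge> 1 \<longrightarrow> weakly_shift_stable (interleaving_closure n X)))"
  \<comment> \<open>The closure is an interleaving of decimations, so its claim follows from the
    other two.\<close>
  by (simp add: interleaving_closure_def weakly_shift_stable_decimation
      weakly_shift_stable_interleaving)

end
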